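(* Let $d \ge 1$, let $U$ be a unitary operator on $\mathbb{C}^d$, and let $z \in \mathbb{C}^d$ satisfy $\|z\| = 1$. Put $\Theta := \operatorname{span}\{z\}^\perp$, let $P := \mathbb{I} - |z\rangle\langle z|$ be the orthogonal projection onto $\Theta$, and for each eigenvalue $\lambda \in \sigma(U)$ put $V_\lambda := \operatorname{Ker}(U - \lambda \mathbb{I})$. Then $$\sum_{n=0}^{\infty} \|(PU)^n z\|^2 = d - \sum_{\lambda \in \sigma(U)} \dim(\Theta \cap V_\lambda).$$
   Context: $\mathbb{C}^d$ carries the standard Hermitian inner product and Euclidean norm $\|\cdot\|$. $|z\rangle\langle z|$ is the orthogonal projection onto $\operatorname{span}\{z\}$. $\sigma(U)$ denotes the set of (distinct) eigenvalues of $U$. The zeroth power of any operator is the identity. Dimensions are over $\mathbb{C}$. *)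

theory Defs
  imports "HOL-Analysis.Analysis"
begin

text \<open>
  The type \<open>complex ^ 'd\<close> carries the Euclidean norm, but the library's inner product on it is the
  real one (the real part of the Hermitian one). As in bra-ket notation, the Hermitian inner product
  is linear in its second argument. Complex spans, subspaces and dimensions are
  \<open>vec.span\<close>, \<open>vec.subspace\<close> and \<open>vec.dim\<close>; the unqualified names are the real versions.
\<close>

definition hinner :: "complex ^ 'd \<Rightarrow> complex ^ 'd \<Rightarrow> complex"
  where "hinner x y = (\<Sum>i\<in>UNIV. cnj (x $ i) * y $ i)"

definition unitary_op :: "(complex ^ 'd \<Rightarrow> complex ^ 'd) \<Rightarrow> bool"
  where "unitary_op U \<longleftrightarrow>
    Vector_Spaces.linear (*s) (*s) U \<and> surj U \<and> (\<forall>x y. hinner (U x) (U y) = hinner x y)"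

definition hcomplement :: "(complex ^ 'd) set \<Rightarrow> (complex ^ 'd) set"
  where "hcomplement S = {v. \<forall>w\<in>S. hinner w v = 0}"

text \<open>The operator \<open>|z><z|\<close>. It is the orthogonal projection onto the span of \<open>z\<close> if
  \<open>norm z = 1\<close>.\<close>

definition ketbra :: "complex ^ 'd \<Rightarrow> complex ^ 'd \<Rightarrow> complex ^ 'd"
  where "ketbra z v = hinner z v *s z"

definition eigenspace :: "(complex ^ 'd \<Rightarrow> complex ^ 'd) \<Rightarrow> complex \<Rightarrow> (complex ^ 'd) set"
  where "eigenspace U l = {v. U v - l *s v = 0}"

definition eigenvalues :: "(complex ^ 'd \<Rightarrow> complex ^ 'd) \<Rightarrow> complex set"
  where "eigenvalues U = {l. \<exists>v. v \<noteq> 0 \<and> U v = l *s v}"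

lemma hinner_self: "hinner x x = of_real ((norm x)\<^sup>2)"
proof -
  have "(norm x)\<^sup>2 = (\<Sum>i\<in>UNIV. (norm (x $ i))\<^sup>2)"
    unfolding norm_vec_def L2_set_def by (simp add: sum_nonneg)
  then show ?thesis
    by (simp add: hinner_def complex_norm_square mult.commute flip: of_real_power)
qed

lemma hinner_add_right: "hinner x (y + z) = hinner x y + hinner x z"
  by (simp add: hinner_def sum.distrib algebra_simps)

lemma hinner_diff_right: "hinner x (y - z) = hinner x y - hinner x z"
  by (simp add: hinner_def sum_subtractf algebra_simps)

lemma hinner_scale_right: "hinner x (c *s y) = c * hinner x y"
  by (simp add: hinner_def sum_distrib_left algebra_simps)

lemma hinner_scale_left: "hinner (c *s x) y = cnj c * hinner x y"
  by (simp add: hinner_def sum_distrib_left algebra_simps)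

lemma ketbra_in_span: "ketbra z v \<in> vec.span {z}"
  by (simp add: ketbra_def vec.span_base vec.span_scale)

lemma minus_ketbra_in_hcomplement:
  assumes "norm z = 1"
  shows "v - ketbra z v \<in> hcomplement (vec.span {z})"
  using assms
  by (auto simp: hcomplement_def vec.span_singleton ketbra_def hinner_scale_left
      hinner_diff_right hinner_scale_right hinner_self)

text \<open>The spectrum is finite, so sums over it are genuine finite sums.\<close>

lemma finite_eigenvalues:
  assumes "unitary_op (U :: complex ^ 'd \<Rightarrow> complex ^ 'd)"
  shows "finite (eigenvalues U)"
proof -
  have pres: "hinner (U x) (U y) = hinner x y" for x y
    using assms by (simp add: unitary_op_def)
  have "\<forall>l\<in>eigenvalues U. \<exists>v. v \<noteq> 0 \<and> U v = l *s v"
    by (auto simp: eigenvalues_def)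
  then obtain e where e: "\<And>l. l \<in> eigenvalues U \<Longrightarrow> e l \<noteq> 0 \<and> U (e l) = l *s e l"
    by metis
  have nz: "hinner x x \<noteq> 0" if "x \<noteq> 0" for x :: "complex ^ 'd"
    using that by (simp add: hinner_self)
  have unit: "cnj l * l = 1" if "l \<in> eigenvalues U" for l
  proof -
    have "hinner (e l) (e l) = cnj l * (l * hinner (e l) (e l))"
      using pres[of "e l" "e l"] e[OF that] by (metis hinner_scale_left hinner_scale_right mult.left_commute)
    then have "hinner (e l) (e l) = (cnj l * l) * hinner (e l) (e l)" by (simp only: mult.assoc)
    then show ?thesis using nz[of "e l"] e[OF that] by (metis mult_cancel_right1)
  qed
  have orth: "hinner (e l) (e m) = 0"
    if "l \<in> eigenvalues U" "m \<in> eigenvalues U" "l \<noteq> m" for l m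
  proof (rule ccontr)
    assume n: "hinner (e l) (e m) \<noteq> 0"
    have "hinner (e l) (e m) = cnj l * (m * hinner (e l) (e m))"
      using pres[of "e l" "e m"] e[OF that(1)] e[OF that(2)]
      by (metis hinner_scale_left hinner_scale_right mult.left_commute)
    with n have "cnj l * m = cnj l * l" using unit[OF that(1)] by simp
    moreover have "cnj l \<noteq> 0" using unit[OF that(1)] by auto
    ultimately show False using that(3) by simp
  qed
  have inj: "inj_on e (eigenvalues U)"
  proof (rule inj_onI, rule ccontr)
    fix l m assume *: "l \<in> eigenvalues U" "m \<in> eigenvalues U" "e l = e m" "l \<noteq> m"
    show False using orth[OF *(1,2,4)] *(3) nz[of "e m"] e[OF *(2)] by simp
  qed
  have "vec.independent (e ` eigenvalues U)"
  proof
    assume "vec.dependent (e ` eigenvalues U)"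
    then obtain l where l: "l \<in> eigenvalues U" "e l \<in> vec.span (e ` eigenvalues U - {e l})"
      by (auto simp: vec.dependent_def)
    have "hinner (e l) w = 0" if "w \<in> vec.span (e ` eigenvalues U - {e l})" for w
      using that
    proof (induction rule: vec.span_induct_alt)
      case base
      show ?case by (simp add: hinner_def)
    next
      case (step c x y)
      then obtain m where "m \<in> eigenvalues U" "m \<noteq> l" "x = e m" by auto
      then have "hinner (e l) x = 0" using orth[OF l(1)] by metis
      then show ?case using step by (simp add: hinner_add_right hinner_scale_right)
    qed
    then show False using l(2) nz e[OF l(1)] by blast
  qed
  then have "finite (e ` eigenvalues U)" by (rule vec.finiteI_independent)
  then show ?thesis using inj by (rule finite_imageD)
qed

end

(*
  Put T = P U and let A = U^-1 P be its adjoint. Since |A v|^2 = |v|^2 - |<z,v>|^2, the sum of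
  |<T^n z, v>|^2 over n < N telescopes to |v|^2 - |A^N v|^2. Take a maximal orthonormal set B of
  eigenvectors of U orthogonal to z. On the span of B, A is isometric. On its orthogonal complement
  A^N tends to 0: a limit point of an orbit keeps its norm under all powers of A, hence is orthogonal
  to all T^n z; such vectors form a subspace on which A agrees with U^-1, so if it were nonzero it
  would contain a further eigenvector. Summing over the standard basis vectors v gives the limit
  d - card B, and B restricts to a basis of the intersection of each eigenspace with the complement
  of z.
*)
theory Submission
  imports Defs "HOL-Computational_Algebra.Fundamental_Theorem_Algebra"
begin

section \<open>The Hermitian inner product\<close>

lemma hinner_commute: "cnj (hinner x y) = hinner y x"
  by (simp add: hinner_def mult.commute)

lemma hinner_diff_left: "hinner (x - y) w = hinner x w - hinner y w"
  by (simp add: hinner_def sum_subtractf algebra_simps)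

lemma hinner_zero_right [simp]: "hinner x 0 = 0"
  by (simp add: hinner_def)

lemma hinner_zero_left [simp]: "hinner 0 x = 0"
  by (simp add: hinner_def)

lemma hinner_sum_right: "hinner x (\<Sum>i\<in>I. f i) = (\<Sum>i\<in>I. hinner x (f i))"
  by (induction I rule: infinite_finite_induct) (simp_all add: hinner_add_right)

lemma hinner_eq_zero_commute: "hinner x y = 0 \<longleftrightarrow> hinner y x = 0"
  by (metis complex_cnj_zero_iff hinner_commute)

lemma hinner_self_eq_zero: "hinner x x = 0 \<longleftrightarrow> x = 0"
  by (simp add: hinner_self)

lemma hinner_ext:
  assumes "\<And>w. hinner w x = hinner w y"
  shows "x = y"
  using assms[of "x - y"] hinner_self_eq_zero[of "x - y"] by (simp add: hinner_diff_right)

lemma hinner_axis: "hinner x (axis i 1) = cnj (x $ i)"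
proof -
  have "hinner x (axis i 1) = (\<Sum>j\<in>UNIV. if j = i then cnj (x $ j) else 0)"
    unfolding hinner_def axis_def by (rule sum.cong) auto
  then show ?thesis by simp
qed

lemma norm_square_eq_sum_components: "(norm x)\<^sup>2 = (\<Sum>i\<in>UNIV. (cmod (x $ i))\<^sup>2)"
  unfolding norm_vec_def L2_set_def by (simp add: sum_nonneg)

text \<open>Parseval for the standard basis, with the basis vector in the second slot, where
  \<open>energy_identity\<close> has its free vector.\<close>

lemma norm_square_eq_sum_axis:
  "(norm x)\<^sup>2 = (\<Sum>i\<in>UNIV. (cmod (hinner x (axis i 1)))\<^sup>2)"
  by (simp add: hinner_axis norm_square_eq_sum_components)

lemma norm_mult_vec: "norm (c *s x) = cmod c * norm (x :: complex ^ 'd)"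
  by (rule power2_eq_imp_eq)
     (simp_all add: norm_square_eq_sum_components norm_mult power_mult_distrib sum_distrib_left)

lemma pythagoras_ketbra:
  assumes "norm z = 1"
  shows "(norm (v - ketbra z v))\<^sup>2 + (cmod (hinner z v))\<^sup>2 = (norm v)\<^sup>2"
proof -
  have zz: "hinner z z = 1" using assms by (simp add: hinner_self)
  let ?w = "v - ketbra z v"
  have 1: "hinner z ?w = 0"
    by (simp add: ketbra_def hinner_diff_right hinner_scale_right zz)
  have "hinner ?w ?w = hinner ?w v"
    using 1 hinner_eq_zero_commute[of z ?w] hinner_diff_right[of ?w v "ketbra z v"]
    by (simp add: ketbra_def hinner_scale_right)
  also have "\<dots> = hinner v v - cnj (hinner z v) * hinner z v"
    by (simp add: hinner_diff_left ketbra_def hinner_scale_left)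
  finally have "of_real ((norm ?w)\<^sup>2) = (of_real ((norm v)\<^sup>2) :: complex) - of_real ((cmod (hinner z v))\<^sup>2)"
    by (simp add: hinner_self complex_norm_square mult.commute flip: of_real_power)
  then have "(norm ?w)\<^sup>2 = (norm v)\<^sup>2 - (cmod (hinner z v))\<^sup>2"
    by (metis of_real_diff of_real_eq_iff)
  then show ?thesis by simp
qed

section \<open>Orthonormal sets\<close>

definition orthonormal :: "(complex ^ 'd) set \<Rightarrow> bool"
  where "orthonormal B \<longleftrightarrow> (\<forall>b\<in>B. norm b = 1) \<and> (\<forall>b\<in>B. \<forall>c\<in>B. b \<noteq> c \<longrightarrow> hinner b c = 0)"

lemma orthonormal_hinner:
  "orthonormal B \<Longrightarrow> b \<in> B \<Longrightarrow> c \<in> B \<Longrightarrow> hinner b c = (if b = c then 1 else 0)"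
  by (auto simp: orthonormal_def hinner_self)

lemma orthonormal_hinner_sum:
  assumes "orthonormal B" "finite B" "b \<in> B"
  shows "hinner b (\<Sum>c\<in>B. f c *s c) = f b"
proof -
  have "hinner b (\<Sum>c\<in>B. f c *s c) = (\<Sum>c\<in>B. if b = c then f c else 0)"
    unfolding hinner_sum_right hinner_scale_right
    by (rule sum.cong) (auto simp: orthonormal_hinner[OF assms(1,3)])
  then show ?thesis using assms by simp
qed

lemma orthonormal_independent:
  assumes "orthonormal B"
  shows "vec.independent B"
proof
  assume "vec.dependent B"
  then obtain t u v where t: "finite t" "t \<subseteq> B" "(\<Sum>v\<in>t. u v *s v) = 0" "v \<in> t" "u v \<noteq> 0"
    unfolding vec.dependent_explicit by blast
  have "orthonormal t" using assms t(2) by (auto simp: orthonormal_def)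
  from orthonormal_hinner_sum[OF this t(1,4), of u] t show False by simp
qed

lemma orthonormal_finite: "orthonormal B \<Longrightarrow> finite B"
  by (rule vec.finiteI_independent) (rule orthonormal_independent)

lemma orthonormal_card_le:
  fixes B :: "(complex ^ 'd) set"
  assumes "orthonormal B"
  shows "card B \<le> CARD('d)"
  using vec.independent_card_le_dim[OF subset_UNIV orthonormal_independent[OF assms]]
  by (simp only: vec_dim_card)

definition orthoproj :: "(complex ^ 'd) set \<Rightarrow> complex ^ 'd \<Rightarrow> complex ^ 'd"
  where "orthoproj B v = (\<Sum>b\<in>B. hinner b v *s b)"

lemma hinner_minus_orthoproj:
  "orthonormal B \<Longrightarrow> b \<in> B \<Longrightarrow> hinner b (v - orthoproj B v) = 0"
  by (simp add: hinner_diff_right orthoproj_def orthonormal_hinner_sum orthonormal_finite)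

lemma norm_orthoproj:
  assumes "orthonormal B"
  shows "(norm (orthoproj B v))\<^sup>2 = (\<Sum>b\<in>B. (cmod (hinner b v))\<^sup>2)"
proof -
  have "complex_of_real ((norm (orthoproj B v))\<^sup>2) = (\<Sum>b\<in>B. hinner b v * hinner (orthoproj B v) b)"
    unfolding hinner_self[symmetric]
    by (subst (2) orthoproj_def) (simp add: hinner_sum_right hinner_scale_right)
  also have "\<dots> = (\<Sum>b\<in>B. hinner b v * cnj (hinner b v))"
  proof (rule sum.cong)
    fix b assume b: "b \<in> B"
    then have "hinner b (orthoproj B v) = hinner b v"
      using assms by (simp add: orthoproj_def orthonormal_hinner_sum orthonormal_finite)
    then show "hinner b v * hinner (orthoproj B v) b = hinner b v * cnj (hinner b v)"
      by (metis hinner_commute)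
  qed simp
  also have "\<dots> = of_real (\<Sum>b\<in>B. (cmod (hinner b v))\<^sup>2)"
    by (simp add: complex_norm_square flip: of_real_power)
  finally show ?thesis by (metis of_real_eq_iff)
qed

text \<open>The trace of an orthogonal projection is its rank: after the two sums are swapped, each
  \<open>b\<close> contributes its own squared norm 1.\<close>

lemma sum_norm_orthoproj_axis:
  assumes "orthonormal B"
  shows "(\<Sum>i\<in>UNIV. (norm (orthoproj B (axis i 1)))\<^sup>2) = real (card B)"
proof -
  have "(\<Sum>i\<in>UNIV. (norm (orthoproj B (axis i 1)))\<^sup>2)
      = (\<Sum>b\<in>B. \<Sum>i\<in>UNIV. (cmod (hinner b (axis i 1)))\<^sup>2)"
    unfolding norm_orthoproj[OF assms] by (rule sum.swap)
  also have "\<dots> = (\<Sum>b\<in>B. (norm b)\<^sup>2)"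
    by (simp only: norm_square_eq_sum_axis)
  also have "\<dots> = real (card B)" using assms by (simp add: orthonormal_def)
  finally show ?thesis .
qed

section \<open>Eigenvectors in invariant subspaces\<close>

definition poly_apply :: "(complex ^ 'd \<Rightarrow> complex ^ 'd) \<Rightarrow> complex poly \<Rightarrow> complex ^ 'd \<Rightarrow> complex ^ 'd"
  where "poly_apply A p v = (\<Sum>i\<le>degree p. coeff p i *s (A ^^ i) v)"

text \<open>Coefficients beyond the degree vanish, so polynomials of different degrees can be summed
  over one common range and compared coefficientwise.\<close>

lemma poly_apply_bound:
  assumes "degree p \<le> n"
  shows "poly_apply A p v = (\<Sum>i\<le>n. coeff p i *s (A ^^ i) v)"
  unfolding poly_apply_def using assms
  by (intro sum.mono_neutral_left) (auto simp: coeff_eq_0)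

lemma poly_apply_diff: "poly_apply A (p - q) v = poly_apply A p v - poly_apply A q v"
proof -
  let ?n = "max (degree p) (degree q)"
  have "poly_apply A (p - q) v = (\<Sum>i\<le>?n. coeff (p - q) i *s (A ^^ i) v)"
    by (rule poly_apply_bound) (rule degree_diff_le_max)
  then show ?thesis
    by (simp add: poly_apply_bound[of p ?n] poly_apply_bound[of q ?n] sum_subtractf
        vec.scale_left_diff_distrib)
qed

lemma poly_apply_smult: "poly_apply A (smult c p) v = c *s poly_apply A p v"
  by (simp add: poly_apply_bound[of _ "degree p"] vec.scale_sum_right)

lemma poly_apply_shift:
  assumes "Vector_Spaces.linear (*s) (*s) A"
  shows "poly_apply A (pCons 0 p) v = A (poly_apply A p v)"
proof -
  have "poly_apply A (pCons 0 p) v = (\<Sum>i\<le>Suc (degree p). coeff (pCons 0 p) i *s (A ^^ i) v)"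
    by (rule poly_apply_bound) (rule degree_pCons_le)
  also have "\<dots> = (\<Sum>i\<le>degree p. coeff p i *s A ((A ^^ i) v))"
    by (subst sum.atMost_Suc_shift) simp
  also have "\<dots> = A (poly_apply A p v)"
    by (simp add: poly_apply_def vec.linear_sum[OF assms] vec.linear_scale[OF assms])
  finally show ?thesis .
qed

lemma poly_apply_in_subspace:
  assumes "vec.subspace S" "\<And>x. x \<in> S \<Longrightarrow> A x \<in> S" "v \<in> S"
  shows "poly_apply A p v \<in> S"
proof -
  have "(A ^^ i) v \<in> S" for i by (induction i) (auto simp: assms)
  then show ?thesis
    unfolding poly_apply_def by (intro vec.subspace_sum vec.subspace_scale assms(1))
qed

text \<open>The d + 1 vectors from \<open>v\<close> to \<open>(A ^^ d) v\<close> are linearly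
  dependent, and the coefficients of a dependence form \<open>p\<close>. Dependence is a property of
  the set of these vectors, so a repetition among them is treated separately: there a difference of
  two monomials annihilates \<open>v\<close>.\<close>

lemma annihilating_poly_exists:
  fixes A :: "complex ^ 'd \<Rightarrow> complex ^ 'd"
  shows "\<exists>p. p \<noteq> 0 \<and> poly_apply A p v = 0"
proof (cases "inj_on (\<lambda>i. (A ^^ i) v) {..CARD('d)}")
  case True
  let ?O = "(\<lambda>i. (A ^^ i) v) ` {..CARD('d)}"
  have "card ?O = Suc CARD('d)" using True by (simp add: card_image)
  then have "vec.dependent ?O"
    using vec.independent_card_le_dim[OF subset_UNIV, of ?O]
      dim_subset_UNIV_cart_gen[of "UNIV :: (complex ^ 'd) set"] by force
  then obtain u where u: "\<exists>w\<in>?O. u w \<noteq> 0" "(\<Sum>w\<in>?O. u w *s w) = 0"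
    by (subst (asm) vec.dependent_finite) auto
  define p where "p = (\<Sum>i\<le>CARD('d). monom (u ((A ^^ i) v)) i)"
  have cp: "coeff p i = (if i \<le> CARD('d) then u ((A ^^ i) v) else 0)" for i
    by (simp add: p_def coeff_sum)
  have "p \<noteq> 0"
  proof
    assume "p = 0"
    then have "u ((A ^^ i) v) = 0" if "i \<le> CARD('d)" for i using cp[of i] that by simp
    then show False using u(1) by auto
  qed
  moreover have "poly_apply A p v = (\<Sum>i\<le>CARD('d). u ((A ^^ i) v) *s (A ^^ i) v)"
    by (subst poly_apply_bound[of _ "CARD('d)"]) (auto simp: cp intro: degree_le)
  then have "poly_apply A p v = 0"
    using u(2) True by (simp add: sum.reindex)
  ultimately show ?thesis by blast
next
  case False
  then obtain i j where ij: "i \<noteq> j" "(A ^^ i) v = (A ^^ j) v"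
    by (auto simp: inj_on_def)
  have m: "poly_apply A (monom 1 k) v = (A ^^ k) v" for k
  proof -
    have "poly_apply A (monom 1 k) v = (\<Sum>i\<le>k. if i = k then (A ^^ i) v else 0)"
      unfolding poly_apply_def degree_monom_eq[OF one_neq_zero]
      by (rule sum.cong) auto
    then show ?thesis by simp
  qed
  have "coeff (monom 1 i - monom 1 j) i = (1 :: complex)" using ij(1) by simp
  then have "monom 1 i - monom 1 j \<noteq> (0 :: complex poly)" by (metis coeff_0 zero_neq_one)
  moreover have "poly_apply A (monom 1 i - monom 1 j) v = 0"
    by (simp add: poly_apply_diff m ij(2))
  ultimately show ?thesis by blast
qed

text \<open>Split a linear factor X - l off an annihilating polynomial of least degree. By
  minimality the cofactor \<open>q\<close> does not annihilate \<open>v\<close>, while A - l kills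
  \<open>poly_apply A q v\<close>, which lies in \<open>S\<close> by invariance.\<close>

lemma eigenvector_in_invariant_subspace:
  fixes A :: "complex ^ 'd \<Rightarrow> complex ^ 'd"
  assumes lin: "Vector_Spaces.linear (*s) (*s) A"
    and S: "vec.subspace S" "\<And>x. x \<in> S \<Longrightarrow> A x \<in> S"
    and v: "v \<in> S" "v \<noteq> 0"
  shows "\<exists>w l. w \<in> S \<and> w \<noteq> 0 \<and> A w = l *s w"
proof -
  let ?annihilates = "\<lambda>p. p \<noteq> 0 \<and> poly_apply A p v = 0"
  obtain p\<^sub>0 where "?annihilates p\<^sub>0" using annihilating_poly_exists by blast
  from ex_has_least_nat[of ?annihilates, OF this, of degree]
  obtain p where p: "p \<noteq> 0" "poly_apply A p v = 0"
    and minimal: "\<And>q. q \<noteq> 0 \<Longrightarrow> poly_apply A q v = 0 \<Longrightarrow> degree p \<le> degree q"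
    by auto
  \<comment> \<open>A root requires a nonconstant \<open>p\<close>; a nonzero constant would send
    \<open>v\<close> to a nonzero multiple of itself.\<close>
  have "degree p \<noteq> 0"
  proof
    assume "degree p = 0"
    then obtain c where "p = [:c:]" by (rule degree_eq_zeroE)
    with p v show False by (simp add: poly_apply_def)
  qed
  then obtain l where "poly p l = 0"
    using fundamental_theorem_of_algebra constant_degree by metis
  then obtain q where q: "p = [:-l, 1:] * q" by (auto simp: poly_eq_0_iff_dvd)
  then have "q \<noteq> 0" using p by auto
  then have "degree p = Suc (degree q)" unfolding q by (subst degree_mult_eq) auto
  then have nz: "poly_apply A q v \<noteq> 0" using minimal[of q] \<open>q \<noteq> 0\<close> by auto
  have "p = pCons 0 q - smult l q" unfolding q by simp
  then have "A (poly_apply A q v) = l *s poly_apply A q v"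
    using p(2) by (simp add: poly_apply_diff poly_apply_smult poly_apply_shift[OF lin])
  moreover have "poly_apply A q v \<in> S" by (rule poly_apply_in_subspace) (use S v in auto)
  ultimately show ?thesis using nz by blast
qed

section \<open>Orbits of the projected unitary operator\<close>

text \<open>A subsequence of the bounded orbit converges to some \<open>y\<close> in
  \<open>S\<close>. The norms along the orbit decrease to a limit \<open>c\<close>, and every
  iterate of \<open>y\<close> has norm \<open>c\<close>, so \<open>strict\<close> forces
  \<open>y = 0\<close> and hence \<open>c = 0\<close>.\<close>

lemma nonexpansive_orbit_tendsto_zero:
  fixes A :: "'a :: {real_normed_vector, heine_borel} \<Rightarrow> 'a"
  assumes cont: "continuous_on UNIV A"
    and closed: "closed S" and inv: "\<And>x. x \<in> S \<Longrightarrow> A x \<in> S"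
    and nonexp: "\<And>x. norm (A x) \<le> norm x"
    and strict: "\<And>x. x \<in> S \<Longrightarrow> (\<And>n. norm ((A ^^ n) x) = norm x) \<Longrightarrow> x = 0"
    and v: "v \<in> S"
  shows "(\<lambda>n. norm ((A ^^ n) v)) \<longlonglongrightarrow> 0"
proof -
  let ?x = "\<lambda>n. (A ^^ n) v"
  have xS: "?x n \<in> S" for n by (induction n) (auto simp: v inv)
  have dec: "decseq (\<lambda>n. norm (?x n))" by (rule decseq_SucI) (simp add: nonexp)
  then obtain c where c: "(\<lambda>n. norm (?x n)) \<longlonglongrightarrow> c"
    using decseq_convergent[of _ 0] by (metis norm_ge_zero)
  have "bounded (range ?x)"
    unfolding bounded_iff using decseqD[OF dec, of 0] by auto
  then obtain y r where r: "strict_mono r" "(?x \<circ> r) \<longlonglongrightarrow> y"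
    using bounded_imp_convergent_subsequence by blast
  have yS: "y \<in> S" using closed_sequentially[OF closed _ r(2)] xS by auto
  have ny: "norm ((A ^^ n) y) = c" for n
  proof -
    have "continuous_on UNIV (A ^^ n)"
    proof (induction n)
      case (Suc n)
      then show ?case using continuous_on_compose2[OF cont Suc] by (simp add: o_def)
    qed (simp add: id_def)
    then have "(\<lambda>k. norm ((A ^^ n) (?x (r k)))) \<longlonglongrightarrow> norm ((A ^^ n) y)"
      by (rule tendsto_norm[OF continuous_on_tendsto_compose, OF _ r(2)[unfolded o_def]]) auto
    \<comment> \<open>Applying \<open>A ^^ n\<close> to the chosen subsequence only shifts its
      indices by \<open>n\<close>, so the result is again a subsequence of the orbit and its norms
      tend to the same \<open>c\<close>.\<close>
    moreover have "strict_mono (\<lambda>k. n + r k)" using r(1) by (simp add: strict_mono_def)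
    from LIMSEQ_subseq_LIMSEQ[OF c this] have "(\<lambda>k. norm ((A ^^ n) (?x (r k)))) \<longlonglongrightarrow> c"
      by (simp add: o_def funpow_add)
    ultimately show ?thesis using LIMSEQ_unique by blast
  qed
  have "y = 0" using strict[OF yS] ny ny[of 0] by simp
  then show ?thesis using c ny[of 0] by simp
qed

section \<open>The operator \<open>T\<close>, its adjoint \<open>A\<close> and the energy
  identity\<close>

locale projected_unitary =
  fixes U :: "complex ^ 'd \<Rightarrow> complex ^ 'd" and z :: "complex ^ 'd"
  assumes unitary: "unitary_op U" and unit: "norm z = 1"
begin

definition T :: "complex ^ 'd \<Rightarrow> complex ^ 'd"
  where "T v = U v - ketbra z (U v)"

definition A :: "complex ^ 'd \<Rightarrow> complex ^ 'd"
  where "A v = inv U (v - ketbra z v)"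

lemma U_linear: "Vector_Spaces.linear (*s) (*s) U"
  and U_surj: "surj U"
  and U_hinner: "hinner (U x) (U y) = hinner x y"
  using unitary by (auto simp: unitary_op_def)

lemma U_inv: "U (inv U v) = v"
  by (rule surj_f_inv_f[OF U_surj])

lemma norm_U: "norm (U v) = norm v"
proof -
  have "complex_of_real ((norm (U v))\<^sup>2) = of_real ((norm v)\<^sup>2)"
    using U_hinner[of v v] by (simp add: hinner_self)
  then show ?thesis by (simp only: of_real_eq_iff power2_eq_iff_nonneg[OF norm_ge_zero norm_ge_zero])
qed

lemma inj_U: "inj U"
proof (rule injI)
  fix x y assume "U x = U y"
  then have "norm (U (x - y)) = 0"
    by (simp add: vec.linear_diff[OF U_linear])
  then show "x = y" by (simp add: norm_U)
qed

text \<open>Applying \<open>U\<close> to both arguments on the right turns \<open>A y\<close> into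
  the projection of \<open>y\<close>, and the projection is self-adjoint.\<close>

lemma adjoint: "hinner (T x) y = hinner x (A y)"
proof -
  have "hinner x (A y) = hinner (U x) (y - ketbra z y)"
    unfolding A_def by (metis U_hinner U_inv)
  then show ?thesis
    by (simp add: T_def ketbra_def hinner_diff_left hinner_diff_right hinner_scale_left
        hinner_scale_right hinner_commute)
qed

lemma adjoint_pow: "hinner ((T ^^ n) x) y = hinner x ((A ^^ n) y)"
  by (induction n arbitrary: y) (simp_all add: adjoint funpow_swap1[of A])

text \<open>Linearity is read off from the adjoint relation: \<open>hinner\<close> is linear in its
  second argument, and a vector is determined by its products with all others.\<close>

lemma A_linear: "Vector_Spaces.linear (*s) (*s) A"
proof -
  have "A (x + y) = A x + A y" for x y
    by (rule hinner_ext) (simp add: hinner_add_right flip: adjoint)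
  moreover have "A (c *s x) = c *s A x" for c x
    by (rule hinner_ext) (simp add: hinner_scale_right flip: adjoint)
  ultimately show ?thesis
    unfolding Vector_Spaces.linear_iff by (simp add: vec.vector_space_axioms)
qed

lemma A_pow_linear: "Vector_Spaces.linear (*s) (*s) (A ^^ n)"
  unfolding Vector_Spaces.linear_iff
  by (induction n)
     (simp_all add: vec.vector_space_axioms vec.linear_add[OF A_linear] vec.linear_scale[OF A_linear])

text \<open>\<open>U\<close> preserves norms and maps \<open>A v\<close> to the projection of
  \<open>v\<close>, so \<open>A\<close> loses exactly the component of \<open>v\<close> along
  \<open>z\<close>.\<close>

lemma norm_A: "(norm (A v))\<^sup>2 + (cmod (hinner z v))\<^sup>2 = (norm v)\<^sup>2"
  using pythagoras_ketbra[OF unit, of v] norm_U[of "A v"] by (simp add: A_def U_inv)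

lemma norm_A_le: "norm (A v) \<le> norm v"
  using norm_A[of v] zero_le_power2[of "cmod (hinner z v)"]
  by (intro power2_le_imp_le[OF _ norm_ge_zero]) linarith

lemma A_continuous: "continuous_on UNIV A"
proof (rule continuous_onI)
  fix x and e :: real assume "e > 0"
  then show "\<exists>d>0. \<forall>x'\<in>UNIV. dist x' x < d \<longrightarrow> dist (A x') (A x) \<le> e"
    by (intro exI[of _ e])
      (auto simp: dist_norm simp flip: vec.linear_diff[OF A_linear] intro: order_trans[OF norm_A_le])
qed

text \<open>Iterate \<open>norm_A\<close>: the component along \<open>z\<close> lost in passing from
  \<open>(A ^^ n) v\<close> to the next iterate is \<open>hinner ((T ^^ n) z) v\<close>, by
  \<open>adjoint_pow\<close>.\<close>

lemma energy_identity:
  "(\<Sum>n<N. (cmod (hinner ((T ^^ n) z) v))\<^sup>2) + (norm ((A ^^ N) v))\<^sup>2 = (norm v)\<^sup>2"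
proof (induction N)
  case (Suc N)
  then show ?case using norm_A[of "(A ^^ N) v"] by (simp add: adjoint_pow)
qed simp

section \<open>Eigenvectors of \<open>U\<close> orthogonal to \<open>z\<close>\<close>

definition orthonormal_eigenvectors :: "(complex ^ 'd) set \<Rightarrow> bool"
  where "orthonormal_eigenvectors B \<longleftrightarrow>
    orthonormal B \<and> (\<forall>b\<in>B. hinner z b = 0 \<and> (\<exists>l. U b = l *s b))"

text \<open>Cardinalities of orthonormal sets are bounded by d, so one of largest cardinality exists
  among the admissible sets. A nonzero \<open>v\<close> violating the second property could be
  normalised and added to it.\<close>

lemma maximal_orthonormal_eigenvectors_exist:
  obtains B where "orthonormal_eigenvectors B"
    "\<And>v l. \<forall>b\<in>B. hinner b v = 0 \<Longrightarrow> hinner z v = 0 \<Longrightarrow> U v = l *s v \<Longrightarrow> v = 0"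
proof -
  have "orthonormal_eigenvectors {}" by (simp add: orthonormal_eigenvectors_def orthonormal_def)
  moreover have "\<forall>B. orthonormal_eigenvectors B \<longrightarrow> card B < Suc CARD('d)"
    using orthonormal_card_le by (auto simp: orthonormal_eigenvectors_def less_Suc_eq_le)
  ultimately have "\<exists>B. orthonormal_eigenvectors B \<and>
      (\<forall>C. orthonormal_eigenvectors C \<longrightarrow> card C \<le> card B)"
    by (rule ex_has_greatest_nat)
  then obtain B where B: "orthonormal_eigenvectors B"
    and maximal: "\<And>C. orthonormal_eigenvectors C \<Longrightarrow> card C \<le> card B"
    by auto
  have "v = 0" if v: "\<forall>b\<in>B. hinner b v = 0" "hinner z v = 0" "U v = l *s v" for v l
  proof (rule ccontr)
    assume "v \<noteq> 0"
    define w where "w = of_real (inverse (norm v)) *s v"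
    have w: "norm w = 1" using \<open>v \<noteq> 0\<close> by (simp add: w_def norm_mult_vec norm_inverse)
    have bw: "hinner b w = 0" "hinner w b = 0" if "b \<in> B" for b
      using v(1) that by (auto simp: w_def hinner_scale_right hinner_eq_zero_commute[of _ b])
    have "U w = l *s w"
      by (simp add: w_def vec.linear_scale[OF U_linear] v(3) vec.scale_left_commute)
    then have "orthonormal_eigenvectors (insert w B)"
      using B w bw v(2) by (auto simp: orthonormal_eigenvectors_def orthonormal_def w_def hinner_scale_right)
    then have "card (insert w B) \<le> card B" by (rule maximal)
    moreover have "w \<notin> B" using bw(1)[of w] w hinner_self[of w] by auto
    moreover have "finite B" using B by (simp add: orthonormal_eigenvectors_def orthonormal_finite)
    ultimately show False by simp
  qed
  with B show ?thesis by (rule that)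
qed

lemma eigenvalue_unimodular:
  assumes "U v = l *s v" "v \<noteq> 0"
  shows "cnj l * l = 1"
proof -
  have "cmod l * norm v = norm v" using norm_U[of v] by (simp add: assms(1) norm_mult_vec)
  then have "cmod l = 1" using assms(2) by simp
  then show ?thesis by (metis complex_norm_square mult.commute of_real_1 one_power2)
qed

text \<open>\<open>U\<close> preserves the product but multiplies it by \<open>cnj l * m\<close>. If
  the product were nonzero, this factor would be 1, which is also \<open>cnj l * l\<close>, forcing
  l = m.\<close>

lemma eigenvectors_orthogonal:
  assumes "U v = l *s v" "U w = m *s w" "l \<noteq> m"
  shows "hinner v w = 0"
proof (rule ccontr)
  assume n: "hinner v w \<noteq> 0"
  have "cnj l * m * hinner v w = hinner v w"
    using U_hinner[of v w] by (simp add: assms(1,2) hinner_scale_left hinner_scale_right mult_ac)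
  with n have "cnj l * m = 1" by simp
  moreover have "v \<noteq> 0" using n by auto
  then have "cnj l * l = 1" using assms(1) by (rule eigenvalue_unimodular[rotated])
  ultimately have "cnj l * m = cnj l * l" "cnj l \<noteq> 0" by auto
  with assms(3) show False by simp
qed

lemma A_eigenvector:
  assumes "U b = l *s b" "hinner z b = 0"
  shows "A b = inverse l *s b"
\<comment> \<open>For \<open>b = 0\<close> the hypotheses allow \<open>l = 0\<close>, where
  \<open>inverse l\<close> does not invert \<open>l\<close>.\<close>
proof (cases "b = 0")
  case False
  then have "l \<noteq> 0" using eigenvalue_unimodular[OF assms(1)] by auto
  then have "U (inverse l *s b) = b"
    by (simp add: vec.linear_scale[OF U_linear] assms(1))
  then have "inv U b = inverse l *s b" by (metis inv_f_f inj_U)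
  then show ?thesis by (simp add: A_def ketbra_def assms(2))
qed (simp add: vec.linear_0[OF A_linear])

text \<open>Moved to the other side, the powers of \<open>T\<close> become powers of
  \<open>A\<close>, which only rescale \<open>b\<close>. Hence \<open>b\<close> contributes nothing
  to the sum in \<open>energy_identity\<close>.\<close>

lemma orbit_orthogonal_eigenvector:
  assumes "U b = l *s b" "hinner z b = 0"
  shows "hinner ((T ^^ n) z) b = 0"
proof -
  have "(A ^^ n) b = inverse l ^ n *s b"
    by (induction n) (simp_all add: A_eigenvector[OF assms] vec.linear_scale[OF A_linear] mult.commute)
  then show ?thesis by (simp add: adjoint_pow hinner_scale_right assms(2))
qed

section \<open>Limits of the powers of \<open>A\<close> and the dimension count, for a maximal set
  \<open>B\<close>\<close>

context
  fixes B
  assumes B: "orthonormal_eigenvectors B"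
    and maximal: "\<And>v l. \<forall>b\<in>B. hinner b v = 0 \<Longrightarrow> hinner z v = 0 \<Longrightarrow> U v = l *s v \<Longrightarrow> v = 0"
begin

lemma B_orthonormal: "orthonormal B"
  using B by (simp add: orthonormal_eigenvectors_def)

lemma B_eigenvector:
  assumes "b \<in> B"
  obtains l where "U b = l *s b" "hinner z b = 0" "b \<noteq> 0"
  using assms B by (force simp: orthonormal_eigenvectors_def orthonormal_def)

lemma hinner_orthoproj_B:
  assumes "\<And>b. b \<in> B \<Longrightarrow> hinner x b = 0"
  shows "hinner x (orthoproj B v) = 0"
  using assms by (simp add: orthoproj_def hinner_sum_right hinner_scale_right)

text \<open>The whole orbit of \<open>z\<close> under \<open>T\<close> is orthogonal to
  \<open>B\<close>, so the sum in \<open>energy_identity\<close> vanishes on the span of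
  \<open>B\<close>.\<close>

lemma norm_A_pow_orthoproj: "norm ((A ^^ N) (orthoproj B v)) = norm (orthoproj B v)"
proof -
  have "hinner ((T ^^ n) z) (orthoproj B v) = 0" for n
    by (rule hinner_orthoproj_B) (metis B_eigenvector orbit_orthogonal_eigenvector)
  then show ?thesis using energy_identity[of "orthoproj B v" N] by simp
qed

text \<open>Each \<open>b\<close> is an eigenvector of \<open>T\<close> too, because the projection
  fixes \<open>U b\<close>. The orthogonal complement of eigenvectors of \<open>T\<close> is
  invariant under its adjoint.\<close>

lemma A_orthogonal_invariant:
  assumes "\<forall>b\<in>B. hinner b v = 0"
  shows "\<forall>b\<in>B. hinner b (A v) = 0"
proof
  fix b assume b: "b \<in> B"
  then obtain l where l: "U b = l *s b" "hinner z b = 0" by (rule B_eigenvector)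
  then have "T b = l *s b" by (simp add: T_def ketbra_def hinner_scale_right)
  then have "hinner b (A v) = cnj l * hinner b v"
    by (simp add: hinner_scale_left flip: adjoint)
  then show "hinner b (A v) = 0" using assms b by simp
qed

text \<open>The vectors in question form a subspace \<open>K\<close>, invariant under
  \<open>A\<close> because moving \<open>A\<close> across the product advances the orbit by one
  step. If \<open>K\<close> were nonzero, it would contain an eigenvector \<open>w\<close> of
  \<open>A\<close>. The orbit condition at n = 0 makes \<open>w\<close> orthogonal to
  \<open>z\<close>, so \<open>U\<close> undoes \<open>A\<close> on \<open>w\<close>, and
  \<open>w\<close> is an eigenvector of \<open>U\<close> excluded by maximality.\<close>

lemma orthogonal_to_orbit_eq_zero:
  assumes v: "\<forall>b\<in>B. hinner b v = 0" "\<And>n. hinner ((T ^^ n) z) v = 0"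
  shows "v = 0"
proof (rule ccontr)
  assume "v \<noteq> 0"
  define K where "K = {v. (\<forall>b\<in>B. hinner b v = 0) \<and> (\<forall>n. hinner ((T ^^ n) z) v = 0)}"
  have "vec.subspace K"
    by (auto simp: K_def vec.subspace_def hinner_add_right hinner_scale_right)
  moreover have "A x \<in> K" if x: "x \<in> K" for x
  proof -
    have "hinner ((T ^^ n) z) (A x) = 0" for n
      using x unfolding K_def by (metis (mono_tags, lifting) adjoint funpow.simps(2) mem_Collect_eq o_apply)
    then show ?thesis using x A_orthogonal_invariant by (auto simp: K_def)
  qed
  moreover have "v \<in> K" using v by (simp add: K_def)
  ultimately obtain w l where w: "w \<in> K" "w \<noteq> 0" "A w = l *s w"
    using eigenvector_in_invariant_subspace[OF A_linear] \<open>v \<noteq> 0\<close> by metis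
  have "\<forall>n. hinner ((T ^^ n) z) w = 0" using w(1) by (simp add: K_def)
  then have zw: "hinner z w = 0" by (metis funpow_0)
  then have "U (A w) = w" by (simp add: A_def ketbra_def U_inv)
  then have Uw: "l *s U w = w" by (simp add: w(3) vec.linear_scale[OF U_linear])
  then have "l \<noteq> 0" using w(2) by auto
  have "inverse l *s (l *s U w) = inverse l *s w" by (simp only: Uw)
  then have "U w = inverse l *s w" using \<open>l \<noteq> 0\<close> by simp
  then have "w = 0" using w(1) zw maximal by (auto simp: K_def)
  with w(2) show False by simp
qed

lemma A_pow_tendsto_zero:
  assumes "\<forall>b\<in>B. hinner b v = 0"
  shows "(\<lambda>N. norm ((A ^^ N) v)) \<longlonglongrightarrow> 0"
proof (rule nonexpansive_orbit_tendsto_zero[where S = "{v. \<forall>b\<in>B. hinner b v = 0}"])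
  have "closed {v. hinner b v = 0}" for b :: "complex ^ 'd"
    unfolding hinner_def by (intro closed_Collect_eq continuous_intros)
  then have "closed (\<Inter>b\<in>B. {v. hinner b v = 0})" by blast
  also have "(\<Inter>b\<in>B. {v. hinner b v = 0}) = {v. \<forall>b\<in>B. hinner b v = 0}" by auto
  finally show "closed {v. \<forall>b\<in>B. hinner b v = 0}" .
next
  fix x assume x: "x \<in> {v. \<forall>b\<in>B. hinner b v = 0}" "\<And>n. norm ((A ^^ n) x) = norm x"
  \<comment> \<open>The energy identities for n and n + 1 differ by this one squared term, and equal
    norms of the iterates make the difference zero.\<close>
  have "hinner ((T ^^ n) z) x = 0" for n
    using energy_identity[of x "Suc n"] energy_identity[of x n] x(2)[of n] x(2)[of "Suc n"] by simp
  then show "x = 0" using x(1) by (intro orthogonal_to_orbit_eq_zero) auto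
qed (use assms A_continuous norm_A_le A_orthogonal_invariant in auto)

text \<open>Split \<open>v\<close> into its projection, on which all powers of \<open>A\<close> keep
  the norm, and a remainder orthogonal to \<open>B\<close>, on which they tend to 0. The reverse
  triangle inequality compares the norms.\<close>

lemma norm_A_pow_tendsto: "(\<lambda>N. norm ((A ^^ N) v)) \<longlonglongrightarrow> norm (orthoproj B v)"
proof (rule LIM_zero_cancel, rule Lim_null_comparison)
  let ?q = "orthoproj B v"
  have "norm (norm ((A ^^ N) v) - norm ?q) \<le> norm ((A ^^ N) (v - ?q))" for N
    unfolding norm_A_pow_orthoproj[of N v, symmetric] vec.linear_diff[OF A_pow_linear] real_norm_def
    by (rule norm_triangle_ineq3)
  then show "\<forall>\<^sub>F N in sequentially. norm (norm ((A ^^ N) v) - norm ?q) \<le> norm ((A ^^ N) (v - ?q))"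
    by simp
  show "(\<lambda>N. norm ((A ^^ N) (v - ?q))) \<longlonglongrightarrow> 0"
    by (rule A_pow_tendsto_zero) (simp add: hinner_minus_orthoproj[OF B_orthonormal])
qed

text \<open>Add the energy identities of the standard basis vectors. The ones add up to d, and the
  limits of the remaining terms add up to the trace of the projection onto the span of
  \<open>B\<close>.\<close>

lemma norm_orbit_sums: "(\<lambda>n. (norm ((T ^^ n) z))\<^sup>2) sums (real CARD('d) - real (card B))"
proof -
  have "(\<Sum>n<N. (norm ((T ^^ n) z))\<^sup>2) = (\<Sum>i\<in>UNIV. 1 - (norm ((A ^^ N) (axis i 1)))\<^sup>2)" for N
  proof -
    have "(\<Sum>n<N. (norm ((T ^^ n) z))\<^sup>2)
        = (\<Sum>i\<in>UNIV. \<Sum>n<N. (cmod (hinner ((T ^^ n) z) (axis i 1)))\<^sup>2)"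
      unfolding norm_square_eq_sum_axis by (rule sum.swap)
    also have "\<dots> = (\<Sum>i\<in>UNIV. 1 - (norm ((A ^^ N) (axis i 1)))\<^sup>2)"
    proof (rule sum.cong)
      fix i :: 'd
      have "complex_of_real ((norm (axis i (1 :: complex)))\<^sup>2) = 1"
        unfolding hinner_self[symmetric] hinner_axis by (simp add: axis_def)
      then have "(norm (axis i (1 :: complex)))\<^sup>2 = 1" by (simp only: of_real_eq_1_iff)
      then show "(\<Sum>n<N. (cmod (hinner ((T ^^ n) z) (axis i 1)))\<^sup>2) = 1 - (norm ((A ^^ N) (axis i 1)))\<^sup>2"
        using energy_identity[of "axis i 1" N] by simp
    qed simp
    finally show ?thesis .
  qed
  moreover have "(\<lambda>N. \<Sum>i\<in>UNIV. 1 - (norm ((A ^^ N) (axis i 1)))\<^sup>2)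
      \<longlonglongrightarrow> (\<Sum>i\<in>UNIV. 1 - (norm (orthoproj B (axis i 1)))\<^sup>2)"
    by (intro tendsto_sum tendsto_diff tendsto_power norm_A_pow_tendsto tendsto_const)
  ultimately show ?thesis
    unfolding sums_def by (simp add: sum_subtractf sum_norm_orthoproj_axis[OF B_orthonormal])
qed

text \<open>The members of \<open>B\<close> in the eigenspace form a basis of the intersection. They
  span it because subtracting from \<open>v\<close> its projection leaves a vector of the same
  eigenspace orthogonal to \<open>z\<close> and \<open>B\<close>, which vanishes by
  maximality.\<close>

lemma card_eigenspace:
  "card (B \<inter> eigenspace U l) = vec.dim (hcomplement (vec.span {z}) \<inter> eigenspace U l)"
proof (rule vec.basis_card_eq_dim)
  have \<Theta>: "v \<in> hcomplement (vec.span {z}) \<longleftrightarrow> hinner z v = 0" for v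
    by (auto simp: hcomplement_def vec.span_singleton hinner_scale_left intro: exI[of _ 1])
  show "B \<inter> eigenspace U l \<subseteq> hcomplement (vec.span {z}) \<inter> eigenspace U l"
    by (auto simp: \<Theta> elim: B_eigenvector)
  show "vec.independent (B \<inter> eigenspace U l)"
    using orthonormal_independent[OF B_orthonormal] by (rule vec.independent_mono) simp
  show "hcomplement (vec.span {z}) \<inter> eigenspace U l \<subseteq> vec.span (B \<inter> eigenspace U l)"
  proof
    fix v assume v: "v \<in> hcomplement (vec.span {z}) \<inter> eigenspace U l"
    then have Uv: "U v = l *s v" and zv: "hinner z v = 0" by (auto simp: \<Theta> eigenspace_def)
    \<comment> \<open>Members of \<open>B\<close> with another eigenvalue drop out of the projection
      of \<open>v\<close>, so the projection stays in the eigenspace of \<open>l\<close>.\<close>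
    have other: "hinner b v = 0" if b: "b \<in> B" "b \<notin> eigenspace U l" for b
    proof -
      obtain m where m: "U b = m *s b" using b(1) B_eigenvector by metis
      then have "m \<noteq> l" using b(2) by (auto simp: eigenspace_def)
      then show ?thesis using eigenvectors_orthogonal[OF m Uv] by simp
    qed
    let ?q = "orthoproj B v"
    have q: "?q = (\<Sum>b\<in>B \<inter> eigenspace U l. hinner b v *s b)"
      unfolding orthoproj_def
      by (rule sum.mono_neutral_right) (auto simp: other orthonormal_finite[OF B_orthonormal])
    have Uq: "U ?q = l *s ?q"
      unfolding q vec.linear_sum[OF U_linear] vec.linear_scale[OF U_linear] vec.scale_sum_right
      by (rule sum.cong) (auto simp: eigenspace_def vec.scale_left_commute mult.commute)
    have "v - ?q = 0"
    proof (rule maximal)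
      show "\<forall>b\<in>B. hinner b (v - ?q) = 0"
        by (simp add: hinner_minus_orthoproj[OF B_orthonormal])
      have "hinner z ?q = 0" by (rule hinner_orthoproj_B) (metis B_eigenvector)
      then show "hinner z (v - ?q) = 0" by (simp add: hinner_diff_right zv)
      show "U (v - ?q) = l *s (v - ?q)"
        by (simp add: vec.linear_diff[OF U_linear] Uv Uq vec.scale_right_diff_distrib)
    qed
    then have "v = ?q" by simp
    moreover have "?q \<in> vec.span (B \<inter> eigenspace U l)"
      unfolding q by (intro vec.span_sum vec.span_scale vec.span_base)
    ultimately show "v \<in> vec.span (B \<inter> eigenspace U l)" by simp
  qed
qed

text \<open>Every member of \<open>B\<close> is a nonzero eigenvector and so belongs to exactly one
  eigenvalue: the eigenspaces partition \<open>B\<close>.\<close>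

lemma card_eq_sum_dim:
  "card B = (\<Sum>l\<in>eigenvalues U. vec.dim (hcomplement (vec.span {z}) \<inter> eigenspace U l))"
proof -
  have "B = (\<Union>l\<in>eigenvalues U. B \<inter> eigenspace U l)"
    by (fastforce simp: eigenvalues_def eigenspace_def elim: B_eigenvector)
  also have "card \<dots> = (\<Sum>l\<in>eigenvalues U. card (B \<inter> eigenspace U l))"
  proof (rule card_UN_disjoint)
    show "\<forall>l\<in>eigenvalues U. finite (B \<inter> eigenspace U l)"
      using orthonormal_finite[OF B_orthonormal] by simp
    show "\<forall>l\<in>eigenvalues U. \<forall>m\<in>eigenvalues U. l \<noteq> m \<longrightarrow>
        (B \<inter> eigenspace U l) \<inter> (B \<inter> eigenspace U m) = {}"
      by (auto simp: eigenspace_def elim!: B_eigenvector)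
  qed (rule finite_eigenvalues[OF unitary])
  finally show ?thesis by (simp only: card_eigenspace)
qed

end

end

theorem theorem1:
  fixes U :: "complex ^ 'd \<Rightarrow> complex ^ 'd" and z :: "complex ^ 'd"
    and P :: "complex ^ 'd \<Rightarrow> complex ^ 'd" and \<Theta> :: "(complex ^ 'd) set"
    and V :: "complex \<Rightarrow> (complex ^ 'd) set"
  assumes "unitary_op U"
    and "norm z = 1"
    and "\<Theta> = hcomplement (vec.span {z})"
    and "P = (\<lambda>v. v - ketbra z v)"
    and "\<And>l. l \<in> eigenvalues U \<Longrightarrow> V l = eigenspace U l"
  shows "(\<lambda>n. (norm (((P \<circ> U) ^^ n) z))\<^sup>2) sums
    (real CARD('d) - (\<Sum>l\<in>eigenvalues U. real (vec.dim (\<Theta> \<inter> V l))))"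
proof -
  interpret projected_unitary U z by standard (fact assms)+
  obtain B where B: "orthonormal_eigenvectors B"
    "\<And>v l. \<forall>b\<in>B. hinner b v = 0 \<Longrightarrow> hinner z v = 0 \<Longrightarrow> U v = l *s v \<Longrightarrow> v = 0"
    using maximal_orthonormal_eigenvectors_exist by blast
  have "P \<circ> U = T" by (simp add: fun_eq_iff assms(4) T_def)
  moreover have "real (card B) = (\<Sum>l\<in>eigenvalues U. real (vec.dim (\<Theta> \<inter> V l)))"
  proof -
    have "card B = (\<Sum>l\<in>eigenvalues U. vec.dim (hcomplement (vec.span {z}) \<inter> eigenspace U l))"
      by (rule card_eq_sum_dim[OF B(1)]) (rule B(2))
    then show ?thesis by (simp add: assms(3,5))
  qed
  moreover have "(\<lambda>n. (norm ((T ^^ n) z))\<^sup>2) sums (real CARD('d) - real (card B))"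
    by (rule norm_orbit_sums[OF B(1)]) (rule B(2))
  ultimately show ?thesis by simp
qed

end
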